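(* Let $F=(u,v,f(u,v))$ be an infinitesimally flexible surface with velocity diagram $V=(-v,u,n(u,v))$, and let $L$ denote the (orientation reversing) Euclidean motion $L(x,y,z)=(y,-x,-z)$. Let $c(u,v)$ be a function with $c_u=f_un_{uv}-f_vn_{uu}$, $c_v=f_un_{vv}-f_vn_{uv}$, and let $$C=(-n_u,-n_v,c),\quad \bar C=(-n_v,n_u,n_uu+n_vv-n),$$ $$B=(f_u,f_v,f_uu+f_vv-f),\quad \bar B=(f_v,-f_u,-n_uf_v+n_vf_u-c).$$ Then: (i) The three pairs $(LV,\bar C)$, $(LB,F)$ and $(LC,\bar B)$ are related by the metric duality $\nu$. (ii) The three pairs $(LV,\bar C)$, $(LB,F)$ and $(LC,\bar B)$ are related by Weingarten transformations. (iii) The three pairs $(F,LC)$, $(\bar C,LB)$ and $(\bar B,LV)$ have parallel tangent planes in corresponding points. They are relative minimal surfaces to each other. (iv) The three pairs $(LV,F)$, $(LC,\bar C)$ and $(LB,\bar B)$ each have the same top view. They are dual relative minimal surfaces to each other.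
   Context: The top view of $(x,y,z)\in\mathbb{R}^3$ is $(x,y)$. All functions are sufficiently smooth. Points of different surfaces with the same parameter $(u,v)$ correspond. A surface $F=(u,v,f)$ is infinitesimally flexible with velocity diagram $V=(-v,u,n)$ if $V$ is a non-trivial deformation vector field such that the deformation $F+tV$ preserves, to first order at $t=0$, the metric of the top view and the isotropic Gaussian curvature (for a graph $z=\varphi(x,y)$ this curvature is $\varphi_{xx}\varphi_{yy}-\varphi_{xy}^2$); the condition on $f,n$ is $f_{uu}n_{vv}-2f_{uv}n_{uv}+f_{vv}n_{uu}=0$, which is also the integrability condition for the existence of $c$. $C$ and $\bar C$ are the rotation diagram and translation diagram of $(F,V)$; $\bar B$ and $B$ are those of the reversed pair $(V,F)$. The contact element $(x,y,z,p,q)$ is the point $(x,y,z)$ together with the plane through it with Euclidean normal $(p,q,-1)$. The surfaces, with their tangent planes, have the contact elements $F=(u,v,f,f_u,f_v)$, $V=(-v,u,n,-n_v,n_u)$, $C=(-n_u,-n_v,c,f_v,-f_u)$, $\bar C=(-n_v,n_u,n_uu+n_vv-n,-v,u)$, $B=(f_u,f_v,f_uu+f_vv-f,u,v)$, $\bar B=(f_v,-f_u,-n_uf_v+n_vf_u-c,-n_u,-n_v)$. The map $L$ acts on contact elements by $(x,y,z,p,q)\mapsto(y,-x,-z,-q,p)$. The metric duality $\nu$ (a null polarity) maps the point $(a,b,w)$ to the plane $bx-ay+z-w=0$ and vice versa; on contact elements $\nu(x,y,z,p,q)=(q,-p,z-px-qy,-y,x)$. Two surfaces are related by $\nu$ if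 $\nu$ maps the contact elements (point and tangent plane) of one to those of the other at equal parameters. Two surfaces $X,\bar X$ are related by a Weingarten transformation if the straight line connecting corresponding points lies in both tangent planes there and in this correspondence any conjugate curve network on $X$ is associated with a conjugate curve network on $\bar X$. Two surfaces $X(u,v),Y(u,v)$ with parallel tangent planes at corresponding points are relative minimal surfaces to each other if the relative mean curvature of one with respect to the other, taken as relative Gauss image, vanishes, i.e. the linear map (relative Weingarten map) between the parallel tangent planes given by $X_u\mapsto Y_u$, $X_v\mapsto Y_v$ has vanishing trace; it does not matter which of the two surfaces is taken as relative Gauss image. Two surfaces with the same top view at corresponding points are dual relative minimal surfaces to each other if $\nu$ maps them to a pair of relative minimal surfaces; for graphs $z=\varphi(x,y)$ and $z=\psi(x,y)$ over the common top view this is characterized by $\varphi_{xx}\psi_{yy}-2\varphi_{xy}\psi_{xy}+\varphi_{yy}\psi_{xx}=0$. *)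

theory Defs
  imports "HOL-Analysis.Analysis"
begin

definition Du :: "(real \<times> real \<Rightarrow> 'a::real_normed_vector) \<Rightarrow> real \<times> real \<Rightarrow> 'a" where
  "Du g w = vector_derivative (\<lambda>s. g (s, snd w)) (at (fst w))"

definition Dv :: "(real \<times> real \<Rightarrow> 'a::real_normed_vector) \<Rightarrow> real \<times> real \<Rightarrow> 'a" where
  "Dv g w = vector_derivative (\<lambda>s. g (fst w, s)) (at (snd w))"

primrec Ck_on :: "nat \<Rightarrow> (real \<times> real) set \<Rightarrow> (real \<times> real \<Rightarrow> 'a::real_normed_vector) \<Rightarrow> bool" where
  "Ck_on 0 U g \<longleftrightarrow> continuous_on U g"
| "Ck_on (Suc k) U g \<longleftrightarrow> g differentiable_on U \<and> Ck_on k U (Du g) \<and> Ck_on k U (Dv g)"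

definition differential :: "(real \<times> real \<Rightarrow> 'a::real_normed_vector) \<Rightarrow> real \<times> real \<Rightarrow> real \<times> real \<Rightarrow> 'a" where
  "differential g w a = fst a *\<^sub>R Du g w + snd a *\<^sub>R Dv g w"

definition regular_at :: "(real \<times> real \<Rightarrow> 'a::real_normed_vector) \<Rightarrow> real \<times> real \<Rightarrow> bool" where
  "regular_at g w \<longleftrightarrow> Du g w \<noteq> Dv g w \<and> independent {Du g w, Dv g w}"

type_synonym point = "real \<times> real \<times> real"

type_synonym contact = "real \<times> real \<times> real \<times> real \<times> real"

fun top_view :: "point \<Rightarrow> real \<times> real" where
  "top_view (x, y, z) = (x, y)"

fun height :: "point \<Rightarrow> real" where
  "height (x, y, z) = z"

fun pt :: "contact \<Rightarrow> point" where
  "pt (x, y, z, p, q) = (x, y, z)"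

fun normal :: "contact \<Rightarrow> point" where
  "normal (x, y, z, p, q) = (p, q, -1)"

definition tangent_plane :: "contact \<Rightarrow> point set" where
  "tangent_plane e = {P. (P - pt e) \<bullet> normal e = 0}"

text \<open>A surface is carried by its contact elements, so that it has a tangent plane at every
  parameter value, including those at which the point map is not an immersion.\<close>

definition contact_surface :: "(real \<times> real) set \<Rightarrow> (real \<times> real \<Rightarrow> contact) \<Rightarrow> bool" where
  "contact_surface U E \<longleftrightarrow> Ck_on 1 U E \<and>
     (\<forall>w\<in>U. Du (pt \<circ> E) w \<bullet> normal (E w) = 0 \<and> Dv (pt \<circ> E) w \<bullet> normal (E w) = 0)"

fun motion_L_pt :: "point \<Rightarrow> point" where
  "motion_L_pt (x, y, z) = (y, -x, -z)"

fun motion_L :: "contact \<Rightarrow> contact" where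
  "motion_L (x, y, z, p, q) = (y, -x, -z, -q, p)"

fun nu_plane :: "point \<Rightarrow> point set" where
  "nu_plane (a, b, w) = {(x, y, z). b * x - a * y + z - w = 0}"

fun nu :: "contact \<Rightarrow> contact" where
  "nu (x, y, z, p, q) = (q, -p, z - p * x - q * y, -y, x)"

lemma pt_motion_L: "pt (motion_L e) = motion_L_pt (pt e)"
  by (cases e) simp

lemma tangent_plane_motion_L: "tangent_plane (motion_L e) = motion_L_pt ` tangent_plane e"
proof -
  obtain x y z p q where e: "e = (x, y, z, p, q)" by (cases e)
  show ?thesis
  proof (intro set_eqI iffI)
    fix P assume "P \<in> tangent_plane (motion_L e)"
    moreover obtain a b c where P: "P = (a, b, c)" by (cases P)
    ultimately have "(-b, a, -c) \<in> tangent_plane e"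
      by (simp add: tangent_plane_def e inner_prod_def algebra_simps)
    moreover have "P = motion_L_pt (-b, a, -c)" by (simp add: P)
    ultimately show "P \<in> motion_L_pt ` tangent_plane e" by blast
  next
    fix P assume "P \<in> motion_L_pt ` tangent_plane e"
    then show "P \<in> tangent_plane (motion_L e)"
      by (auto simp: tangent_plane_def e inner_prod_def algebra_simps)
  qed
qed

lemma tangent_plane_nu: "tangent_plane (nu e) = nu_plane (pt e)"
  by (cases e) (auto simp: tangent_plane_def inner_prod_def algebra_simps)

lemma nu_plane_nu: "nu_plane (pt (nu e)) = tangent_plane e"
  by (cases e) (auto simp: tangent_plane_def inner_prod_def algebra_simps)

definition nu_related :: "(real \<times> real) set \<Rightarrow> (real \<times> real \<Rightarrow> contact) \<Rightarrow> (real \<times> real \<Rightarrow> contact) \<Rightarrow> bool" where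
  "nu_related U E E' \<longleftrightarrow> contact_surface U E \<and> contact_surface U E' \<and> (\<forall>w\<in>U. nu (E w) = E' w)"

text \<open>The normal is not normalized; this only rescales the form by a nowhere vanishing function,
  because the differential of the point map is orthogonal to the normal.\<close>

definition second_form :: "(real \<times> real \<Rightarrow> contact) \<Rightarrow> real \<times> real \<Rightarrow> real \<times> real \<Rightarrow> real \<times> real \<Rightarrow> real" where
  "second_form E w a b = - (differential (pt \<circ> E) w a \<bullet> differential (normal \<circ> E) w b)"

text \<open>The curves of the network are the images of the coordinate lines of \<open>G\<close>.\<close>

definition curve_network :: "(real \<times> real) set \<Rightarrow> (real \<times> real) set \<Rightarrow> (real \<times> real \<Rightarrow> real \<times> real) \<Rightarrow> bool" where
  "curve_network U G \<phi> \<longleftrightarrow>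
     open G \<and> \<phi> ` G \<subseteq> U \<and> inj_on \<phi> G \<and> Ck_on 1 G \<phi> \<and> (\<forall>s\<in>G. regular_at \<phi> s)"

definition conjugate_network ::
  "(real \<times> real) set \<Rightarrow> (real \<times> real \<Rightarrow> contact) \<Rightarrow> (real \<times> real) set \<Rightarrow> (real \<times> real \<Rightarrow> real \<times> real) \<Rightarrow> bool" where
  "conjugate_network U E G \<phi> \<longleftrightarrow>
     curve_network U G \<phi> \<and> (\<forall>s\<in>G. second_form E (\<phi> s) (Du \<phi> s) (Dv \<phi> s) = 0)"

definition weingarten_related :: "(real \<times> real) set \<Rightarrow> (real \<times> real \<Rightarrow> contact) \<Rightarrow> (real \<times> real \<Rightarrow> contact) \<Rightarrow> bool" where
  "weingarten_related U E E' \<longleftrightarrow> contact_surface U E \<and> contact_surface U E' \<and>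
     (\<forall>w\<in>U. affine hull {pt (E w), pt (E' w)} \<subseteq> tangent_plane (E w) \<inter> tangent_plane (E' w)) \<and>
     (\<forall>G \<phi>. conjugate_network U E G \<phi> \<longrightarrow> conjugate_network U E' G \<phi>)"

definition parallel_tangent_planes :: "(real \<times> real) set \<Rightarrow> (real \<times> real \<Rightarrow> contact) \<Rightarrow> (real \<times> real \<Rightarrow> contact) \<Rightarrow> bool" where
  "parallel_tangent_planes U E E' \<longleftrightarrow> (\<forall>w\<in>U. affine_parallel (tangent_plane (E w)) (tangent_plane (E' w)))"

text \<open>\<open>M\<close> is the matrix, in the basis \<open>X\<^sub>u, X\<^sub>v\<close>, of the linear map with
  \<open>X\<^sub>u \<mapsto> Y\<^sub>u\<close> and \<open>X\<^sub>v \<mapsto> Y\<^sub>v\<close>.\<close>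

definition relative_weingarten_matrix ::
  "(real \<times> real \<Rightarrow> point) \<Rightarrow> (real \<times> real \<Rightarrow> point) \<Rightarrow> real \<times> real \<Rightarrow> real^2^2 \<Rightarrow> bool" where
  "relative_weingarten_matrix X Y w M \<longleftrightarrow>
     Du Y w = (M $ 1 $ 1) *\<^sub>R Du X w + (M $ 2 $ 1) *\<^sub>R Dv X w \<and>
     Dv Y w = (M $ 1 $ 2) *\<^sub>R Du X w + (M $ 2 $ 2) *\<^sub>R Dv X w"

text \<open>The relative Weingarten map only makes sense where its source surface is regular. Both choices
  of the relative Gauss image are required, each at the parameters where the map exists; where both
  surfaces are regular the two maps are inverse to each other and the two requirements agree.\<close>

definition relative_mean_curvature_vanishes ::
  "(real \<times> real) set \<Rightarrow> (real \<times> real \<Rightarrow> point) \<Rightarrow> (real \<times> real \<Rightarrow> point) \<Rightarrow> bool" where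
  "relative_mean_curvature_vanishes U X Y \<longleftrightarrow>
     (\<forall>w\<in>U. regular_at X w \<longrightarrow> (\<exists>M. relative_weingarten_matrix X Y w M \<and> trace M = 0))"

definition relative_minimal :: "(real \<times> real) set \<Rightarrow> (real \<times> real \<Rightarrow> contact) \<Rightarrow> (real \<times> real \<Rightarrow> contact) \<Rightarrow> bool" where
  "relative_minimal U E E' \<longleftrightarrow> contact_surface U E \<and> contact_surface U E' \<and>
     parallel_tangent_planes U E E' \<and>
     relative_mean_curvature_vanishes U (pt \<circ> E) (pt \<circ> E') \<and>
     relative_mean_curvature_vanishes U (pt \<circ> E') (pt \<circ> E)"

definition same_top_view :: "(real \<times> real) set \<Rightarrow> (real \<times> real \<Rightarrow> contact) \<Rightarrow> (real \<times> real \<Rightarrow> contact) \<Rightarrow> bool" where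
  "same_top_view U E E' \<longleftrightarrow> (\<forall>w\<in>U. top_view (pt (E w)) = top_view (pt (E' w)))"

definition dual_relative_minimal :: "(real \<times> real) set \<Rightarrow> (real \<times> real \<Rightarrow> contact) \<Rightarrow> (real \<times> real \<Rightarrow> contact) \<Rightarrow> bool" where
  "dual_relative_minimal U E E' \<longleftrightarrow> contact_surface U E \<and> contact_surface U E' \<and>
     same_top_view U E E' \<and> relative_minimal U (nu \<circ> E) (nu \<circ> E')"

definition top_view_metric :: "(real \<times> real \<Rightarrow> point) \<Rightarrow> real \<times> real \<Rightarrow> real \<times> real \<Rightarrow> real \<times> real \<Rightarrow> real" where
  "top_view_metric X w a b = differential (top_view \<circ> X) w a \<bullet> differential (top_view \<circ> X) w b"

text \<open>The function whose graph is \<open>X ` U\<close>, for \<open>X\<close> with injective top view on \<open>U\<close>. For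
  \<open>X = (u, v, f) + t (-v, u, n)\<close> the top view is an invertible linear map for every \<open>t\<close>.\<close>

definition graph_function :: "(real \<times> real) set \<Rightarrow> (real \<times> real \<Rightarrow> point) \<Rightarrow> real \<times> real \<Rightarrow> real" where
  "graph_function U X = (\<lambda>p. height (X (inv_into U (top_view \<circ> X) p)))"

definition isotropic_gauss_curvature :: "(real \<times> real) set \<Rightarrow> (real \<times> real \<Rightarrow> point) \<Rightarrow> real \<times> real \<Rightarrow> real" where
  "isotropic_gauss_curvature U X w =
     (let \<phi> = graph_function U X; p = top_view (X w)
      in Du (Du \<phi>) p * Dv (Dv \<phi>) p - (Dv (Du \<phi>) p)\<^sup>2)"

text \<open>Velocity fields of one-parameter groups of isotropic motions, which act on the top view by
  Euclidean motions and on the third coordinate by adding an affine function of the top view.\<close>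

definition trivial_velocity :: "(real \<times> real) set \<Rightarrow> (real \<times> real \<Rightarrow> point) \<Rightarrow> (real \<times> real \<Rightarrow> point) \<Rightarrow> bool" where
  "trivial_velocity U X V \<longleftrightarrow>
     (\<exists>\<omega> \<alpha> \<beta> a b c. \<forall>w\<in>U. \<forall>x y z. X w = (x, y, z) \<longrightarrow>
        V w = (- \<omega> * y + \<alpha>, \<omega> * x + \<beta>, a * x + b * y + c))"

definition infinitesimally_flexible :: "(real \<times> real) set \<Rightarrow> (real \<times> real \<Rightarrow> point) \<Rightarrow> (real \<times> real \<Rightarrow> point) \<Rightarrow> bool" where
  "infinitesimally_flexible U X V \<longleftrightarrow>
     \<not> trivial_velocity U X V \<and>
     (\<forall>w\<in>U. \<forall>a b.
        ((\<lambda>t. top_view_metric (\<lambda>w. X w + t *\<^sub>R V w) w a b) has_real_derivative 0) (at 0)) \<and>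
     (\<forall>w\<in>U.
        ((\<lambda>t. isotropic_gauss_curvature U (\<lambda>w. X w + t *\<^sub>R V w) w) has_real_derivative 0) (at 0))"

definition surf_F :: "(real \<times> real \<Rightarrow> real) \<Rightarrow> real \<times> real \<Rightarrow> contact" where
  "surf_F f = (\<lambda>(u, v). (u, v, f (u, v), Du f (u, v), Dv f (u, v)))"

definition surf_V :: "(real \<times> real \<Rightarrow> real) \<Rightarrow> real \<times> real \<Rightarrow> contact" where
  "surf_V n = (\<lambda>(u, v). (-v, u, n (u, v), - Dv n (u, v), Du n (u, v)))"

definition surf_C ::
  "(real \<times> real \<Rightarrow> real) \<Rightarrow> (real \<times> real \<Rightarrow> real) \<Rightarrow> (real \<times> real \<Rightarrow> real) \<Rightarrow> real \<times> real \<Rightarrow> contact" where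
  "surf_C f n c = (\<lambda>(u, v).
     (- Du n (u, v), - Dv n (u, v), c (u, v), Dv f (u, v), - Du f (u, v)))"

definition surf_C_bar :: "(real \<times> real \<Rightarrow> real) \<Rightarrow> real \<times> real \<Rightarrow> contact" where
  "surf_C_bar n = (\<lambda>(u, v).
     (- Dv n (u, v), Du n (u, v), Du n (u, v) * u + Dv n (u, v) * v - n (u, v), -v, u))"

definition surf_B :: "(real \<times> real \<Rightarrow> real) \<Rightarrow> real \<times> real \<Rightarrow> contact" where
  "surf_B f = (\<lambda>(u, v).
     (Du f (u, v), Dv f (u, v), Du f (u, v) * u + Dv f (u, v) * v - f (u, v), u, v))"

definition surf_B_bar ::
  "(real \<times> real \<Rightarrow> real) \<Rightarrow> (real \<times> real \<Rightarrow> real) \<Rightarrow> (real \<times> real \<Rightarrow> real) \<Rightarrow> real \<times> real \<Rightarrow> contact" where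
  "surf_B_bar f n c = (\<lambda>(u, v).
     (Dv f (u, v), - Du f (u, v),
      - Du n (u, v) * Dv f (u, v) + Dv n (u, v) * Du f (u, v) - c (u, v),
      - Du n (u, v), - Dv n (u, v)))"

end

theory Submission
  imports Defs
begin

text \<open>A field \<open>(x, y, z, p, q)\<close> of contact elements touches its surface if \<open>dz = p dx + q dy\<close>.
  All four assertions follow from this relation and from relations of the form
  \<open>dx \<and> dp + dy \<and> dq = 0\<close>, which is its exterior derivative.

  The six surfaces fall into three pairs that \<open>\<nu>\<close> exchanges (lemma \<open>nu_surf\<close>), so it is enough to
  see that \<open>F\<close>, \<open>V\<close> and \<open>C\<close> are contact surfaces; for \<open>C\<close> this is what the equations for \<open>c\<close> say.
  Because \<open>\<nu>\<close> is a null polarity, the line joining related points lies in both tangent planes.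
  Moreover \<open>\<nu>\<close> interchanges top view and slopes up to rotations, and therefore turns the second
  fundamental form \<open>- (dx dp + dy dq)\<close> into its negative with the arguments exchanged
  (\<open>second_form_nu\<close>). The form is symmetric exactly if \<open>dx \<and> dp + dy \<and> dq = 0\<close>; then conjugate
  directions remain conjugate, and \<open>\<nu>\<close> induces a Weingarten transformation.

  Two surfaces with the same slopes have parallel tangent planes, and since no tangent plane is
  vertical, the relative Weingarten map can be computed in the top view. Its trace vanishes if
  \<open>dx \<and> dy' + dx' \<and> dy = 0\<close> (\<open>relative_minimal_if_jacobian\<close>). This relation has the form of the
  previous one, with \<open>(p, q)\<close> replaced by \<open>(y', - x')\<close>.

  For the pairs in question there remain three relations. One is \<open>du \<and> df\<^sub>u + dv \<and> df\<^sub>v = 0\<close>, that is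
  \<open>f\<^sub>u\<^sub>v = f\<^sub>v\<^sub>u\<close>; one is the same for \<open>n\<close>. The third is \<open>df\<^sub>u \<and> dn\<^sub>v + dn\<^sub>u \<and> df\<^sub>v = 0\<close>, which is
  infinitesimal flexibility (\<open>infinitesimally_flexible_jacobian\<close>): it is the first variation of the
  Hessian determinant of \<open>f + t n\<close>, and up to a factor stationary at \<open>t = 0\<close> this determinant is the
  isotropic curvature of \<open>F + t V\<close>.

  Finally \<open>\<nu>\<close> maps each pair with a common top view to one of the relative minimal pairs.\<close>

section \<open>Partial derivatives of functions of two variables\<close>

lemma vector_derivative_along_coordinate_lines:
  assumes "(g has_derivative D) (at w)"
  shows "((\<lambda>s. g (s, snd w)) has_vector_derivative D (1, 0)) (at (fst w))"
    and "((\<lambda>s. g (fst w, s)) has_vector_derivative D (0, 1)) (at (snd w))"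
proof -
  interpret bounded_linear D
    using assms by (rule has_derivative_bounded_linear)
  have "((\<lambda>s. (s, snd w)) has_derivative (\<lambda>s. (s, 0))) (at (fst w))"
    by (intro derivative_eq_intros) auto
  then have "((\<lambda>s. g (s, snd w)) has_derivative (\<lambda>s. D (s, 0))) (at (fst w))"
    by (rule has_derivative_compose) (use assms in simp)
  moreover have "(\<lambda>s. D (s, 0)) = (\<lambda>s. s *\<^sub>R D (1, 0))"
  proof
    show "D (s, 0) = s *\<^sub>R D (1, 0)" for s
      using scaleR[of s "(1, 0)"] by simp
  qed
  ultimately show "((\<lambda>s. g (s, snd w)) has_vector_derivative D (1, 0)) (at (fst w))"
    unfolding has_vector_derivative_def by metis
  have "((\<lambda>s. (fst w, s)) has_derivative (\<lambda>s. (0, s))) (at (snd w))"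
    by (intro derivative_eq_intros) auto
  then have "((\<lambda>s. g (fst w, s)) has_derivative (\<lambda>s. D (0, s))) (at (snd w))"
    by (rule has_derivative_compose) (use assms in simp)
  moreover have "(\<lambda>s. D (0, s)) = (\<lambda>s. s *\<^sub>R D (0, 1))"
  proof
    show "D (0, s) = s *\<^sub>R D (0, 1)" for s
      using scaleR[of s "(0, 1)"] by simp
  qed
  ultimately show "((\<lambda>s. g (fst w, s)) has_vector_derivative D (0, 1)) (at (snd w))"
    unfolding has_vector_derivative_def by metis
qed

lemma partials_eqI:
  assumes "(g has_derivative D) (at w)"
  shows "Du g w = D (1, 0)" and "Dv g w = D (0, 1)"
  unfolding Du_def Dv_def
  by (rule vector_derivative_at vector_derivative_along_coordinate_lines assms)+

lemma has_derivative_differential: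
  assumes "g differentiable (at w)"
  shows "(g has_derivative differential g w) (at w)"
proof -
  obtain D where D: "(g has_derivative D) (at w)"
    using assms by (auto simp: differentiable_def)
  interpret bounded_linear D
    using D by (rule has_derivative_bounded_linear)
  have "D a = differential g w a" for a
    using add[of "fst a *\<^sub>R (1, 0)" "snd a *\<^sub>R (0, 1)"]
    by (simp only: scaleR) (simp add: differential_def partials_eqI[OF D])
  then show ?thesis
    using D by presburger
qed

lemma has_real_derivative_partials:
  fixes g :: "real \<times> real \<Rightarrow> real"
  assumes "g differentiable (at (x, y))"
  shows "((\<lambda>s. g (s, y)) has_real_derivative Du g (x, y)) (at x)"
    and "((\<lambda>s. g (x, s)) has_real_derivative Dv g (x, y)) (at y)"
  using vector_derivative_along_coordinate_lines[OF has_derivative_differential[OF assms]]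
  by (simp_all add: differential_def has_real_derivative_iff_has_vector_derivative)

lemma partials_cong_open:
  assumes "open W" and "w \<in> W" and "\<And>w. w \<in> W \<Longrightarrow> g w = h w"
  shows "Du g w = Du h w" and "Dv g w = Dv h w"
proof -
  have "open ((\<lambda>s. (s, snd w)) -` W)" "open ((\<lambda>s. (fst w, s)) -` W)"
    by (intro open_vimage[OF assms(1)] continuous_intros)+
  moreover have "fst w \<in> (\<lambda>s. (s, snd w)) -` W" "snd w \<in> (\<lambda>s. (fst w, s)) -` W"
    using assms(2) by auto
  ultimately have "eventually (\<lambda>s. s \<in> (\<lambda>s. (s, snd w)) -` W) (nhds (fst w))"
    "eventually (\<lambda>s. s \<in> (\<lambda>s. (fst w, s)) -` W) (nhds (snd w))"
    by (simp_all only: eventually_nhds_in_open)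
  then have "eventually (\<lambda>s. g (s, snd w) = h (s, snd w)) (nhds (fst w))"
    "eventually (\<lambda>s. g (fst w, s) = h (fst w, s)) (nhds (snd w))"
    by (auto elim!: eventually_mono simp: assms(3))
  then show "Du g w = Du h w" and "Dv g w = Dv h w"
    by (auto simp: Du_def Dv_def vector_derivative_cong_eq)
qed

lemma partials_Pair:
  assumes "g differentiable (at w)" and "h differentiable (at w)"
  shows "Du (\<lambda>w. (g w, h w)) w = (Du g w, Du h w)"
    and "Dv (\<lambda>w. (g w, h w)) w = (Dv g w, Dv h w)"
  using partials_eqI[OF has_derivative_Pair[OF assms[THEN has_derivative_differential]]]
  by (simp_all add: differential_def)

lemma partials_coordinates [simp]:
  "Du fst w = 1" "Dv fst w = 0" "Du snd w = 0" "Dv snd w = 1"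
  using partials_eqI[OF bounded_linear_imp_has_derivative[OF bounded_linear_fst], of w]
    partials_eqI[OF bounded_linear_imp_has_derivative[OF bounded_linear_snd], of w]
  by simp_all

lemma partials_const [simp]: "Du (\<lambda>w. k) w = 0" "Dv (\<lambda>w. k) w = 0"
  by (simp_all add: Du_def Dv_def)

lemma partials_minus:
  assumes "g differentiable (at w)"
  shows "Du (\<lambda>w. - g w) w = - Du g w" and "Dv (\<lambda>w. - g w) w = - Dv g w"
  using partials_eqI[OF has_derivative_minus[OF assms[THEN has_derivative_differential]]]
  by (simp_all add: differential_def)

lemma partials_diff:
  assumes "g differentiable (at w)" and "h differentiable (at w)"
  shows "Du (\<lambda>w. g w - h w) w = Du g w - Du h w"
    and "Dv (\<lambda>w. g w - h w) w = Dv g w - Dv h w"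
  using partials_eqI[OF has_derivative_diff[OF assms[THEN has_derivative_differential]]]
  by (simp_all add: differential_def)

lemma partials_mult:
  fixes g h :: "real \<times> real \<Rightarrow> real"
  assumes "g differentiable (at w)" and "h differentiable (at w)"
  shows "Du (\<lambda>w. g w * h w) w = g w * Du h w + Du g w * h w"
    and "Dv (\<lambda>w. g w * h w) w = g w * Dv h w + Dv g w * h w"
  using partials_eqI[OF has_derivative_mult[OF assms[THEN has_derivative_differential]]]
  by (simp_all add: differential_def)

text \<open>Divided by \<open>h\<^sup>2\<close>, the mixed second difference over a square is a value of \<open>Dv (Du f)\<close>
  in that square: the mean value theorem is used once in each direction, first on the difference
  \<open>f (s, b + h) - f (s, b)\<close> as a function of \<open>s\<close>. Since the difference itself does not distinguish
  the two variables, this is what makes mixed partial derivatives commute.\<close>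

lemma second_difference_mean_value:
  fixes f :: "real \<times> real \<Rightarrow> real"
  assumes "0 < h"
    and f: "\<And>w. w \<in> {a..a + h} \<times> {b..b + h} \<Longrightarrow> f differentiable (at w)"
    and fu: "\<And>w. w \<in> {a..a + h} \<times> {b..b + h} \<Longrightarrow> Du f differentiable (at w)"
  shows "\<exists>w \<in> {a..a + h} \<times> {b..b + h}.
    f (a + h, b + h) - f (a + h, b) - f (a, b + h) + f (a, b) = h\<^sup>2 * Dv (Du f) w"
proof -
  have "\<exists>s>a. s < a + h \<and> (f (a + h, b + h) - f (a + h, b)) - (f (a, b + h) - f (a, b)) =
      (a + h - a) * (Du f (s, b + h) - Du f (s, b))"
    by (rule MVT2) (use \<open>0 < h\<close> f in \<open>auto intro!: DERIV_diff has_real_derivative_partials\<close>)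
  then obtain s where s: "a < s" "s < a + h"
    and difference_u: "f (a + h, b + h) - f (a + h, b) - f (a, b + h) + f (a, b) =
      h * (Du f (s, b + h) - Du f (s, b))"
    by auto
  have "\<exists>t>b. t < b + h \<and> Du f (s, b + h) - Du f (s, b) = (b + h - b) * Dv (Du f) (s, t)"
    by (rule MVT2) (use \<open>0 < h\<close> s fu in \<open>auto intro!: has_real_derivative_partials\<close>)
  then obtain t where "b < t" "t < b + h" "Du f (s, b + h) - Du f (s, b) = h * Dv (Du f) (s, t)"
    by auto
  with s difference_u show ?thesis
    by (intro bexI[of _ "(s, t)"]) (auto simp: power2_eq_square)
qed

lemma Ck_on_1_iff:
  assumes "open U"
  shows "Ck_on 1 U g \<longleftrightarrow>
    (\<forall>w\<in>U. g differentiable (at w)) \<and> continuous_on U (Du g) \<and> continuous_on U (Dv g)"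
  using assms by (simp add: differentiable_on_eq_differentiable_at)

lemma Ck_on_2_iff:
  assumes "open U"
  shows "Ck_on 2 U g \<longleftrightarrow>
    (\<forall>w\<in>U. g differentiable (at w)) \<and> Ck_on 1 U (Du g) \<and> Ck_on 1 U (Dv g)"
  using assms by (simp add: differentiable_on_eq_differentiable_at numeral_2_eq_2)

text \<open>The mixed second difference over one small square at \<open>w\<close> is a value of each of the two mixed
  derivatives. If these differed at \<open>w\<close>, then by continuity their values over the square would stay
  within half of the distance, and could not meet.\<close>

lemma mixed_partials_commute:
  fixes f :: "real \<times> real \<Rightarrow> real"
  assumes "open U" and "Ck_on 2 U f" and "w \<in> U"
  shows "Du (Dv f) w = Dv (Du f) w"
proof (rule ccontr)
  assume "Du (Dv f) w \<noteq> Dv (Du f) w"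
  define e where "e = \<bar>Du (Dv f) w - Dv (Du f) w\<bar> / 2"
  have "0 < e"
    using \<open>Du (Dv f) w \<noteq> Dv (Du f) w\<close> by (simp add: e_def)
  obtain a b where w: "w = (a, b)" by (cases w)
  have f: "f differentiable (at w)" and fu: "Du f differentiable (at w)"
    and fv: "Dv f differentiable (at w)" if "w \<in> U" for w
    using assms(2) that unfolding Ck_on_2_iff[OF assms(1)] Ck_on_1_iff[OF assms(1)] by blast+
  have "continuous_on U (Du (Dv f))" "continuous_on U (Dv (Du f))"
    using assms(2) unfolding Ck_on_2_iff[OF assms(1)] Ck_on_1_iff[OF assms(1)] by blast+
  then have "isCont (Du (Dv f)) w" "isCont (Dv (Du f)) w"
    using assms by (auto simp: continuous_on_eq_continuous_at)
  then have "eventually (\<lambda>w'. dist (Du (Dv f) w') (Du (Dv f) w) < e) (nhds w)"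
    "eventually (\<lambda>w'. dist (Dv (Du f) w') (Dv (Du f) w) < e) (nhds w)"
    using \<open>0 < e\<close> by (auto simp: isCont_def tendsto_iff eventually_nhds_conv_at)
  moreover have "eventually (\<lambda>w'. w' \<in> U) (nhds w)"
    using assms by (intro eventually_nhds_in_open)
  ultimately have "eventually (\<lambda>w'. w' \<in> U \<and> dist (Du (Dv f) w') (Du (Dv f) w) < e \<and>
      dist (Dv (Du f) w') (Dv (Du f) w) < e) (nhds w)"
    by eventually_elim simp
  then obtain d where "0 < d" and d: "\<And>w'. dist w' w < d \<Longrightarrow> w' \<in> U \<and>
      dist (Du (Dv f) w') (Du (Dv f) w) < e \<and> dist (Dv (Du f) w') (Dv (Du f) w) < e"
    by (auto simp: eventually_nhds_metric)
  define h where "h = d / 3"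
  have "0 < h"
    using \<open>0 < d\<close> by (simp add: h_def)
  have near: "dist w' w < d" if "w' \<in> {a..a + h} \<times> {b..b + h}" for w'
  proof -
    have "dist w' w \<le> \<bar>fst w' - a\<bar> + \<bar>snd w' - b\<bar>"
      by (simp add: w dist_prod_def dist_real_def sqrt_sum_squares_le_sum_abs)
    also have "\<dots> \<le> h + h"
      using that by auto
    finally show ?thesis
      using \<open>0 < d\<close> by (simp add: h_def)
  qed
  have "\<exists>w1 \<in> {a..a + h} \<times> {b..b + h}.
      f (a + h, b + h) - f (a + h, b) - f (a, b + h) + f (a, b) = h\<^sup>2 * Dv (Du f) w1"
    using \<open>0 < h\<close> by (rule second_difference_mean_value) (intro f fu d[THEN conjunct1] near; assumption)+
  then obtain w1 where w1: "w1 \<in> {a..a + h} \<times> {b..b + h}"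
    "f (a + h, b + h) - f (a + h, b) - f (a, b + h) + f (a, b) = h\<^sup>2 * Dv (Du f) w1"
    by blast
  \<comment> \<open>Exchanging the two variables exchanges the two orders of differentiation.\<close>
  define f' where "f' = f \<circ> prod.swap"
  have swap: "prod.swap differentiable (at w)" for w :: "real \<times> real"
    unfolding prod.swap_def
    by (intro bounded_linear_imp_differentiable bounded_linear_Pair bounded_linear_fst bounded_linear_snd)
  have fu': "Du f' = Dv f \<circ> prod.swap" and fvu': "Dv (Dv f \<circ> prod.swap) = Du (Dv f) \<circ> prod.swap"
    by (auto simp: f'_def Du_def Dv_def fun_eq_iff)
  have "f' differentiable (at w')" "Du f' differentiable (at w')"
    if "w' \<in> {b..b + h} \<times> {a..a + h}" for w'
  proof -
    have "prod.swap w' \<in> U"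
      using that by (intro d[THEN conjunct1] near) auto
    then show "f' differentiable (at w')" "Du f' differentiable (at w')"
      unfolding fu' unfolding f'_def
      by (rule differentiable_chain_at[OF swap f] differentiable_chain_at[OF swap fv])+
  qed
  with \<open>0 < h\<close> have "\<exists>w' \<in> {b..b + h} \<times> {a..a + h}.
      f' (b + h, a + h) - f' (b + h, a) - f' (b, a + h) + f' (b, a) = h\<^sup>2 * Dv (Du f') w'"
    by (rule second_difference_mean_value)
  then obtain w' where "w' \<in> {b..b + h} \<times> {a..a + h}"
    "f' (b + h, a + h) - f' (b + h, a) - f' (b, a + h) + f' (b, a) = h\<^sup>2 * Dv (Du f') w'"
    by blast
  moreover define w2 where "w2 = prod.swap w'"
  ultimately have w2: "w2 \<in> {a..a + h} \<times> {b..b + h}"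
    "f (a + h, b + h) - f (a, b + h) - f (a + h, b) + f (a, b) = h\<^sup>2 * Du (Dv f) w2"
    by (auto simp: fu' fvu') (simp add: f'_def)
  have "h\<^sup>2 * Dv (Du f) w1 = h\<^sup>2 * Du (Dv f) w2"
    using w1(2) w2(2) by linarith
  then have "Dv (Du f) w1 = Du (Dv f) w2"
    using \<open>0 < h\<close> by simp
  moreover have "\<bar>Du (Dv f) w2 - Du (Dv f) w\<bar> < e" "\<bar>Dv (Du f) w1 - Dv (Du f) w\<bar> < e"
    using d[OF near[OF w2(1)]] d[OF near[OF w1(1)]] by (simp_all only: dist_real_def)
  moreover have "\<bar>Du (Dv f) w - Dv (Du f) w\<bar> = 2 * e"
    by (simp add: e_def)
  ultimately show False
    by linarith
qed

section \<open>Continuously differentiable functions\<close>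

text \<open>Smoothness of a contact surface can be read off its five coordinate functions.\<close>

lemma Ck_on_1_Pair_iff:
  assumes "open U"
  shows "Ck_on 1 U (\<lambda>w. (g w, h w)) \<longleftrightarrow> Ck_on 1 U g \<and> Ck_on 1 U h"
proof -
  have "(\<lambda>w. (g w, h w)) differentiable (at w) \<longleftrightarrow> g differentiable (at w) \<and> h differentiable (at w)" for w
  proof
    assume *: "(\<lambda>w. (g w, h w)) differentiable (at w)"
    show "g differentiable (at w) \<and> h differentiable (at w)"
      using has_derivative_fst[OF has_derivative_differential[OF *]]
        has_derivative_snd[OF has_derivative_differential[OF *]]
      by (auto simp: differentiable_def)
  next
    assume "g differentiable (at w) \<and> h differentiable (at w)"
    then show "(\<lambda>w. (g w, h w)) differentiable (at w)"
      by (auto simp: differentiable_def intro: has_derivative_Pair)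
  qed
  moreover have "continuous_on U (Du (\<lambda>w. (g w, h w))) \<longleftrightarrow> continuous_on U (Du g) \<and> continuous_on U (Du h)"
    and "continuous_on U (Dv (\<lambda>w. (g w, h w))) \<longleftrightarrow> continuous_on U (Dv g) \<and> continuous_on U (Dv h)"
    if diff: "\<forall>w\<in>U. g differentiable (at w) \<and> h differentiable (at w)"
  proof -
    have pair: "continuous_on U (\<lambda>w. (k w, l w)) \<longleftrightarrow> continuous_on U k \<and> continuous_on U l"
      for k :: "real \<times> real \<Rightarrow> 'a" and l :: "real \<times> real \<Rightarrow> 'b"
      using continuous_on_fst[of U "\<lambda>w. (k w, l w)"] continuous_on_snd[of U "\<lambda>w. (k w, l w)"]
      by (auto intro: continuous_on_Pair)
    have "continuous_on U (Du (\<lambda>w. (g w, h w))) \<longleftrightarrow> continuous_on U (\<lambda>w. (Du g w, Du h w))"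
      and "continuous_on U (Dv (\<lambda>w. (g w, h w))) \<longleftrightarrow> continuous_on U (\<lambda>w. (Dv g w, Dv h w))"
      using diff by (auto intro!: continuous_on_cong partials_Pair)
    then show "continuous_on U (Du (\<lambda>w. (g w, h w))) \<longleftrightarrow> continuous_on U (Du g) \<and> continuous_on U (Du h)"
      and "continuous_on U (Dv (\<lambda>w. (g w, h w))) \<longleftrightarrow> continuous_on U (Dv g) \<and> continuous_on U (Dv h)"
      by (simp_all only: pair)
  qed
  ultimately show ?thesis
    unfolding Ck_on_1_iff[OF assms] by (smt (verit))
qed

lemma Ck_on_1_differentiable:
  assumes "open U" and "Ck_on 1 U g" and "w \<in> U"
  shows "g differentiable (at w)"
  using assms(2,3) unfolding Ck_on_1_iff[OF assms(1)] by blast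

lemma Ck_on_1_continuous:
  assumes "open U" and "Ck_on 1 U g"
  shows "continuous_on U g"
  using assms by (auto intro!: differentiable_imp_continuous_on)

lemma Ck_on_2_imp_Ck_on_1:
  assumes "open U" and "Ck_on 2 U g"
  shows "Ck_on 1 U g" and "Ck_on 1 U (Du g)" and "Ck_on 1 U (Dv g)"
  using assms(2) Ck_on_1_continuous[OF assms(1), of "Du g"] Ck_on_1_continuous[OF assms(1), of "Dv g"]
  unfolding Ck_on_2_iff[OF assms(1)] Ck_on_1_iff[OF assms(1), of g] by blast+

lemma Ck_on_1_coordinates: "Ck_on 1 U fst" "Ck_on 1 U snd"
  by (auto intro!: bounded_linear_imp_differentiable_on bounded_linear_fst bounded_linear_snd
      simp: partials_coordinates[abs_def])

lemma Ck_on_1_minus: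
  assumes "open U" and "Ck_on 1 U g"
  shows "Ck_on 1 U (\<lambda>w. - g w)"
proof -
  note diff = Ck_on_1_differentiable[OF assms]
  have "continuous_on U (\<lambda>w. - Du g w)" "continuous_on U (\<lambda>w. - Dv g w)"
    using assms(2) unfolding Ck_on_1_iff[OF assms(1)] by (auto intro: continuous_intros)
  then show ?thesis
    unfolding Ck_on_1_iff[OF assms(1)]
    by (simp add: diff partials_minus cong: continuous_on_cong)
qed

lemma Ck_on_1_diff:
  assumes "open U" and "Ck_on 1 U g" and "Ck_on 1 U h"
  shows "Ck_on 1 U (\<lambda>w. g w - h w)"
proof -
  note diff = Ck_on_1_differentiable[OF assms(1,2)] Ck_on_1_differentiable[OF assms(1,3)]
  have "continuous_on U (\<lambda>w. Du g w - Du h w)" "continuous_on U (\<lambda>w. Dv g w - Dv h w)"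
    using assms(2,3) unfolding Ck_on_1_iff[OF assms(1)] by (auto intro: continuous_intros)
  then show ?thesis
    unfolding Ck_on_1_iff[OF assms(1)]
    by (simp add: diff partials_diff cong: continuous_on_cong)
qed

lemma Ck_on_1_mult:
  fixes g h :: "real \<times> real \<Rightarrow> real"
  assumes "open U" and "Ck_on 1 U g" and "Ck_on 1 U h"
  shows "Ck_on 1 U (\<lambda>w. g w * h w)"
proof -
  note diff = Ck_on_1_differentiable[OF assms(1,2)] Ck_on_1_differentiable[OF assms(1,3)]
  have "continuous_on U (\<lambda>w. g w * Du h w + Du g w * h w)"
    "continuous_on U (\<lambda>w. g w * Dv h w + Dv g w * h w)"
    using assms(2,3) Ck_on_1_continuous[OF assms(1,2)] Ck_on_1_continuous[OF assms(1,3)]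
    unfolding Ck_on_1_iff[OF assms(1)] by (auto intro: continuous_intros)
  then show ?thesis
    unfolding Ck_on_1_iff[OF assms(1)]
    by (simp add: diff partials_mult cong: continuous_on_cong)
qed

text \<open>The coefficient of \<open>du \<and> dv\<close> in the 2-form \<open>dg \<and> dh\<close>.\<close>

definition jacobian_det :: "(real \<times> real \<Rightarrow> real) \<Rightarrow> (real \<times> real \<Rightarrow> real) \<Rightarrow> real \<times> real \<Rightarrow> real" where
  "jacobian_det g h w = Du g w * Dv h w - Dv g w * Du h w"

section \<open>Surfaces of contact elements\<close>

lemma contact_components:
  obtains x y z p q where "E = (\<lambda>w. (x w, y w, z w, p w, q w) :: contact)"
proof -
  show thesis
    by (rule that[of "fst \<circ> E" "fst \<circ> snd \<circ> E" "fst \<circ> snd \<circ> snd \<circ> E"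
          "fst \<circ> snd \<circ> snd \<circ> snd \<circ> E" "snd \<circ> snd \<circ> snd \<circ> snd \<circ> E"])
      (simp add: fun_eq_iff)
qed

lemma partials_point:
  assumes "x differentiable (at w)" "y differentiable (at w)" "z differentiable (at w)"
  shows "Du (\<lambda>w. (x w, y w, z w)) w = (Du x w, Du y w, Du z w)"
    and "Dv (\<lambda>w. (x w, y w, z w)) w = (Dv x w, Dv y w, Dv z w)"
proof -
  have "(\<lambda>w. (y w, z w)) differentiable (at w)"
    using assms(2,3) by (auto simp: differentiable_def intro: has_derivative_Pair)
  then show "Du (\<lambda>w. (x w, y w, z w)) w = (Du x w, Du y w, Du z w)"
    and "Dv (\<lambda>w. (x w, y w, z w)) w = (Dv x w, Dv y w, Dv z w)"
    by (simp_all add: assms partials_Pair)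
qed

lemma pt_normal_comp:
  "pt \<circ> (\<lambda>w. (x w, y w, z w, p w, q w)) = (\<lambda>w. (x w, y w, z w))"
  "normal \<circ> (\<lambda>w. (x w, y w, z w, p w, q w)) = (\<lambda>w. (p w, q w, -1))"
  by (simp_all add: fun_eq_iff)

text \<open>A field of contact elements \<open>(x, y, z, p, q)\<close> touches the surface that it carries exactly if
  it satisfies \<open>dz = p dx + q dy\<close>. In this form the invariance of contact surfaces under
  \<open>\<nu>\<close> becomes the product rule.\<close>

lemma contact_surface_iff:
  assumes "open U"
  shows "contact_surface U (\<lambda>w. (x w, y w, z w, p w, q w)) \<longleftrightarrow>
    Ck_on 1 U x \<and> Ck_on 1 U y \<and> Ck_on 1 U z \<and> Ck_on 1 U p \<and> Ck_on 1 U q \<and>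
    (\<forall>w\<in>U. Du z w = p w * Du x w + q w * Du y w \<and> Dv z w = p w * Dv x w + q w * Dv y w)"
    (is "?lhs \<longleftrightarrow> ?C1 \<and> ?C2 \<and> ?C3 \<and> ?C4 \<and> ?C5 \<and> ?dz")
proof -
  have "?lhs \<longleftrightarrow> (?C1 \<and> ?C2 \<and> ?C3 \<and> ?C4 \<and> ?C5) \<and>
    (\<forall>w\<in>U. Du (\<lambda>w. (x w, y w, z w)) w \<bullet> (p w, q w, -1) = 0 \<and>
      Dv (\<lambda>w. (x w, y w, z w)) w \<bullet> (p w, q w, -1) = 0)"
    unfolding contact_surface_def pt_normal_comp Ck_on_1_Pair_iff[OF assms] by simp
  also have "\<dots> \<longleftrightarrow> (?C1 \<and> ?C2 \<and> ?C3 \<and> ?C4 \<and> ?C5) \<and> ?dz"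
  proof (intro conj_cong refl ball_cong)
    fix w assume "?C1 \<and> ?C2 \<and> ?C3 \<and> ?C4 \<and> ?C5" and "w \<in> U"
    then have "x differentiable (at w)" "y differentiable (at w)" "z differentiable (at w)"
      using Ck_on_1_differentiable[OF assms] by blast+
    then show "Du (\<lambda>w. (x w, y w, z w)) w \<bullet> (p w, q w, -1) = 0 \<longleftrightarrow>
        Du z w = p w * Du x w + q w * Du y w"
      and "Dv (\<lambda>w. (x w, y w, z w)) w \<bullet> (p w, q w, -1) = 0 \<longleftrightarrow>
        Dv z w = p w * Dv x w + q w * Dv y w"
      by (auto simp: partials_point algebra_simps)
  qed
  finally show ?thesis
    by blast
qed

lemma contact_surface_motion_L:
  assumes "open U" and "contact_surface U E"
  shows "contact_surface U (motion_L \<circ> E)"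
proof -
  obtain x y z p q where E: "E = (\<lambda>w. (x w, y w, z w, p w, q w))"
    by (rule contact_components)
  have L: "motion_L \<circ> E = (\<lambda>w. (y w, - x w, - z w, - q w, p w))"
    by (simp add: E fun_eq_iff)
  note C1 = assms(2)[unfolded E contact_surface_iff[OF assms(1)]]
  have "x differentiable (at w)" "z differentiable (at w)" if "w \<in> U" for w
    using C1 Ck_on_1_differentiable[OF assms(1) _ that] by blast+
  then show ?thesis
    using C1 unfolding L contact_surface_iff[OF assms(1)]
    by (intro conjI Ck_on_1_minus[OF assms(1)]) (auto simp: partials_minus)
qed

text \<open>\<open>\<nu>\<close> is a Legendre transformation: with \<open>dz = p dx + q dy\<close>,
  \<open>d(z - p x - q y) = - x dp - y dq = q' dy' + p' dx'\<close> for the new coordinates \<open>x' = q\<close>, \<open>y' = - p\<close>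
  and the new slopes \<open>p' = - y\<close>, \<open>q' = x\<close>.\<close>

lemma contact_surface_nu:
  assumes "open U" and "contact_surface U E"
  shows "contact_surface U (nu \<circ> E)"
proof -
  obtain x y z p q where E: "E = (\<lambda>w. (x w, y w, z w, p w, q w))"
    by (rule contact_components)
  have nu: "nu \<circ> E = (\<lambda>w. (q w, - p w, z w - p w * x w - q w * y w, - y w, x w))"
    by (simp add: E fun_eq_iff)
  note C1 = assms(2)[unfolded E contact_surface_iff[OF assms(1)]]
  have "x differentiable (at w)" "y differentiable (at w)" "z differentiable (at w)"
    "p differentiable (at w)" "q differentiable (at w)" if "w \<in> U" for w
    using C1 Ck_on_1_differentiable[OF assms(1) _ that] by blast+
  then show ?thesis
    using C1 unfolding nu contact_surface_iff[OF assms(1)]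
    by (intro conjI Ck_on_1_minus[OF assms(1)] Ck_on_1_diff[OF assms(1)] Ck_on_1_mult[OF assms(1)])
      (auto simp: partials_minus partials_diff partials_mult differentiable_diff differentiable_mult distrib_left)
qed

section \<open>Weingarten transformations\<close>

lemma second_form_components:
  assumes "open U" and "contact_surface U (\<lambda>w. (x w, y w, z w, p w, q w))" and "w \<in> U"
  shows "second_form (\<lambda>w. (x w, y w, z w, p w, q w)) w a b =
    - (differential x w a * differential p w b + differential y w a * differential q w b)"
proof -
  have "x differentiable (at w)" "y differentiable (at w)" "z differentiable (at w)"
    "p differentiable (at w)" "q differentiable (at w)"
    using assms(2) Ck_on_1_differentiable[OF assms(1) _ assms(3)]
    unfolding contact_surface_iff[OF assms(1)] by blast+
  then show ?thesis
    unfolding second_form_def pt_normal_comp by (simp add: differential_def partials_point)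
qed

text \<open>For a contact surface that is twice differentiable the hypothesis is the exterior derivative
  of \<open>dz = p dx + q dy\<close>. The surfaces here are given by coordinates that are only \<open>C\<^sup>1\<close>, and \<open>dz\<close>
  need not be differentiable; the relation \<open>dx \<and> dp + dy \<and> dq = 0\<close> will be checked for each of them.\<close>

lemma second_form_symmetric:
  assumes "open U" and "contact_surface U (\<lambda>w. (x w, y w, z w, p w, q w))" and "w \<in> U"
    and "jacobian_det x p w + jacobian_det y q w = 0"
  shows "second_form (\<lambda>w. (x w, y w, z w, p w, q w)) w a b =
    second_form (\<lambda>w. (x w, y w, z w, p w, q w)) w b a"
proof -
  have "second_form (\<lambda>w. (x w, y w, z w, p w, q w)) w a b -
      second_form (\<lambda>w. (x w, y w, z w, p w, q w)) w b a =
    - (fst a * snd b - snd a * fst b) * (jacobian_det x p w + jacobian_det y q w)"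
    unfolding second_form_components[OF assms(1-3)]
    by (simp add: differential_def jacobian_det_def algebra_simps)
  then show ?thesis
    using assms(4) by simp
qed

text \<open>\<open>\<nu>\<close> exchanges, up to rotations by a right angle, the top view \<open>(x, y)\<close> with the slopes
  \<open>(p, q)\<close>. The second fundamental form pairs the two, so it only changes its sign and the
  order of its arguments.\<close>

lemma second_form_nu:
  assumes "open U" and "contact_surface U E" and "w \<in> U"
  shows "second_form (nu \<circ> E) w a b = - second_form E w b a"
proof -
  obtain x y z p q where E: "E = (\<lambda>w. (x w, y w, z w, p w, q w))"
    by (rule contact_components)
  have nu: "nu \<circ> E = (\<lambda>w. (q w, - p w, z w - p w * x w - q w * y w, - y w, x w))"
    by (simp add: E fun_eq_iff)
  have diff: "p differentiable (at w)" "y differentiable (at w)"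
    using assms(2) Ck_on_1_differentiable[OF assms(1) _ assms(3)]
    unfolding E contact_surface_iff[OF assms(1)] by blast+
  have "contact_surface U (\<lambda>w. (q w, - p w, z w - p w * x w - q w * y w, - y w, x w))"
    using contact_surface_nu[OF assms(1,2)] by (simp only: nu)
  note II' = second_form_components[OF assms(1) this assms(3)]
  note II = second_form_components[OF assms(1) assms(2)[unfolded E] assms(3)]
  show ?thesis
    unfolding nu II' unfolding E II
    by (simp add: differential_def partials_minus diff algebra_simps)
qed

lemma affine_tangent_plane: "affine (tangent_plane e)"
proof -
  have "tangent_plane e = {P. normal e \<bullet> P = normal e \<bullet> pt e}"
    by (auto simp: tangent_plane_def inner_diff_right inner_commute[of _ "normal e"] simp del: split_paired_All)
  then show ?thesis
    by (simp add: affine_hyperplane)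
qed

text \<open>A null polarity maps every point to a plane through that point, so the point of \<open>\<nu> e\<close> lies in
  the plane of \<open>e\<close> and the point of \<open>e\<close> in the plane of \<open>\<nu> e\<close>.\<close>

lemma line_nu_in_tangent_planes:
  "affine hull {pt e, pt (nu e)} \<subseteq> tangent_plane e \<inter> tangent_plane (nu e)"
proof (rule hull_minimal)
  show "{pt e, pt (nu e)} \<subseteq> tangent_plane e \<inter> tangent_plane (nu e)"
    by (cases e) (simp add: tangent_plane_def algebra_simps)
qed (intro affine_Int affine_tangent_plane)

text \<open>Conjugacy is the vanishing of the second fundamental form on the two directions of the network.
  Under \<open>\<nu>\<close> the directions are exchanged, whence the need for symmetry.\<close>

lemma weingarten_related_nu:
  assumes "open U" and "contact_surface U E"
    and sym: "\<And>w a b. w \<in> U \<Longrightarrow> second_form E w a b = second_form E w b a"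
  shows "weingarten_related U E (nu \<circ> E)"
  unfolding weingarten_related_def
proof (intro conjI ballI allI impI)
  show "contact_surface U (nu \<circ> E)"
    using assms(1,2) by (rule contact_surface_nu)
  show "affine hull {pt (E w), pt ((nu \<circ> E) w)} \<subseteq> tangent_plane (E w) \<inter> tangent_plane ((nu \<circ> E) w)" for w
    using line_nu_in_tangent_planes[of "E w"] by simp
  fix G \<phi> assume "conjugate_network U E G \<phi>"
  then have network: "curve_network U G \<phi>"
    and conjugate: "\<And>s. s \<in> G \<Longrightarrow> second_form E (\<phi> s) (Du \<phi> s) (Dv \<phi> s) = 0"
    by (auto simp: conjugate_network_def)
  have "\<phi> s \<in> U" if "s \<in> G" for s
    using network that by (auto simp: curve_network_def)
  then show "conjugate_network U (nu \<circ> E) G \<phi>"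
    using network conjugate sym
    by (simp add: conjugate_network_def second_form_nu[OF assms(1,2)])
qed (fact assms(2))

section \<open>Relative minimal surfaces\<close>

lemma parallel_tangent_planes_same_normal:
  assumes "\<And>w. w \<in> U \<Longrightarrow> normal (E w) = normal (E' w)"
  shows "parallel_tangent_planes U E E'"
  unfolding parallel_tangent_planes_def affine_parallel_def
proof
  fix w assume "w \<in> U"
  let ?a = "pt (E' w) - pt (E w)"
  have "P \<in> tangent_plane (E' w) \<longleftrightarrow> P - ?a \<in> tangent_plane (E w)" for P
    by (simp add: tangent_plane_def assms[OF \<open>w \<in> U\<close>] algebra_simps)
  then have "tangent_plane (E' w) = (+) ?a ` tangent_plane (E w)"
    by (force simp: image_iff)
  then show "\<exists>a. tangent_plane (E' w) = (+) a ` tangent_plane (E w)" ..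
qed

text \<open>No tangent plane of a contact element is vertical, so the projection to the top view is injective
  on it and a regular surface has a regular top view.\<close>

lemma regular_at_imp_jacobian_nonzero:
  assumes "regular_at (\<lambda>w. (x w, y w, z w)) w"
    and "x differentiable (at w)" "y differentiable (at w)" "z differentiable (at w)"
    and "Du z w = p * Du x w + q * Du y w" and "Dv z w = p * Dv x w + q * Dv y w"
  shows "jacobian_det x y w \<noteq> 0"
proof
  assume 0: "jacobian_det x y w = 0"
  let ?X = "\<lambda>w. (x w, y w, z w)"
  have "Du ?X w \<noteq> Dv ?X w" and indep: "independent {Du ?X w, Dv ?X w}"
    using assms(1) by (auto simp: regular_at_def)
  have scalars: "s = 0 \<and> t = 0" if "s *\<^sub>R Du ?X w + t *\<^sub>R Dv ?X w = 0" for s t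
  proof -
    let ?c = "\<lambda>X. if X = Du ?X w then s else t"
    have "(\<Sum>X\<in>{Du ?X w, Dv ?X w}. ?c X *\<^sub>R X) = 0"
      using that \<open>Du ?X w \<noteq> Dv ?X w\<close> by simp
    then have "\<forall>X\<in>{Du ?X w, Dv ?X w}. ?c X = 0"
      using indep by (subst (asm) independent_explicit) (auto simp del: sum.insert split del: if_split)
    then show ?thesis
      using \<open>Du ?X w \<noteq> Dv ?X w\<close> by auto
  qed
  have "Dv y w *\<^sub>R Du ?X w + (- Du y w) *\<^sub>R Dv ?X w = 0"
    and "Dv x w *\<^sub>R Du ?X w + (- Du x w) *\<^sub>R Dv ?X w = 0"
    using 0 by (auto simp: jacobian_det_def partials_point assms(2-) zero_prod_def algebra_simps)
  then have "Du ?X w = 0"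
    using scalars[of "Dv y w" "- Du y w"] scalars[of "Dv x w" "- Du x w"]
    by (simp add: partials_point assms(2-) zero_prod_def)
  then show False
    using indep dependent_zero by auto
qed

text \<open>For the same reason the relative Weingarten map of two surfaces with parallel tangent planes can
  be computed in the top view. With matrices \<open>P\<close> and \<open>Q\<close> of partial derivatives of \<open>(x, y)\<close> and
  \<open>(x', y')\<close> it is \<open>P\<^sup>-\<^sup>1 Q\<close>, and \<open>trace (adj P Q)\<close> is the coefficient of
  \<open>dx \<and> dy' + dx' \<and> dy\<close>, an expression symmetric in the two surfaces.\<close>

lemma relative_mean_curvature_vanishes_if_jacobian:
  assumes "open U"
    and X: "contact_surface U (\<lambda>w. (x w, y w, z w, p w, q w))"
    and X': "contact_surface U (\<lambda>w. (x' w, y' w, z' w, p w, q w))"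
    and mixed: "\<And>w. w \<in> U \<Longrightarrow> jacobian_det x y' w + jacobian_det x' y w = 0"
  shows "relative_mean_curvature_vanishes U (\<lambda>w. (x w, y w, z w)) (\<lambda>w. (x' w, y' w, z' w))"
  unfolding relative_mean_curvature_vanishes_def
proof (intro ballI impI)
  fix w assume "w \<in> U" and regular: "regular_at (\<lambda>w. (x w, y w, z w)) w"
  have diff: "x differentiable (at w)" "y differentiable (at w)" "z differentiable (at w)"
    "x' differentiable (at w)" "y' differentiable (at w)" "z' differentiable (at w)"
    using X X' Ck_on_1_differentiable[OF assms(1) _ \<open>w \<in> U\<close>]
    unfolding contact_surface_iff[OF assms(1)] by blast+
  have contact: "Du z w = p w * Du x w + q w * Du y w" "Dv z w = p w * Dv x w + q w * Dv y w"
    "Du z' w = p w * Du x' w + q w * Du y' w" "Dv z' w = p w * Dv x' w + q w * Dv y' w"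
    using X X' \<open>w \<in> U\<close> unfolding contact_surface_iff[OF assms(1)] by blast+
  define d where "d = jacobian_det x y w"
  have d: "d = Du x w * Dv y w - Dv x w * Du y w" "d \<noteq> 0"
    using regular_at_imp_jacobian_nonzero[OF regular diff(1-3) contact(1,2)]
    by (simp_all add: d_def jacobian_det_def)
  \<comment> \<open>Cramer's rule for the equations of the first two coordinates; the contact condition carries the
    solution over to the third.\<close>
  define \<alpha> \<beta> \<gamma> \<delta> where "\<alpha> = (Du x' w * Dv y w - Du y' w * Dv x w) / d"
    and "\<beta> = (Dv x' w * Dv y w - Dv y' w * Dv x w) / d"
    and "\<gamma> = (Du x w * Du y' w - Du y w * Du x' w) / d"
    and "\<delta> = (Du x w * Dv y' w - Du y w * Dv x' w) / d"
  have u: "Du x' w = \<alpha> * Du x w + \<gamma> * Dv x w" "Du y' w = \<alpha> * Du y w + \<gamma> * Dv y w"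
    and v: "Dv x' w = \<beta> * Du x w + \<delta> * Dv x w" "Dv y' w = \<beta> * Du y w + \<delta> * Dv y w"
    using d(2) unfolding \<alpha>_def \<beta>_def \<gamma>_def \<delta>_def
    by (simp_all add: field_simps) (simp_all add: d(1) algebra_simps)
  let ?M = "vector [vector [\<alpha>, \<beta>], vector [\<gamma>, \<delta>]] :: real^2^2"
  have "relative_weingarten_matrix (\<lambda>w. (x w, y w, z w)) (\<lambda>w. (x' w, y' w, z' w)) w ?M"
    by (simp add: relative_weingarten_matrix_def partials_point diff contact u v algebra_simps)
  moreover have "trace ?M = (jacobian_det x y' w + jacobian_det x' y w) / d"
    by (simp add: trace_def sum_2 \<alpha>_def \<delta>_def jacobian_det_def add_divide_distrib diff_divide_distrib
        mult.commute)
  ultimately show "\<exists>M. relative_weingarten_matrix (\<lambda>w. (x w, y w, z w)) (\<lambda>w. (x' w, y' w, z' w)) w M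
      \<and> trace M = 0"
    using mixed[OF \<open>w \<in> U\<close>] by auto
qed

lemma relative_minimal_if_jacobian:
  assumes "open U"
    and "contact_surface U (\<lambda>w. (x w, y w, z w, p w, q w))"
    and "contact_surface U (\<lambda>w. (x' w, y' w, z' w, p w, q w))"
    and "\<And>w. w \<in> U \<Longrightarrow> jacobian_det x y' w + jacobian_det x' y w = 0"
  shows "relative_minimal U (\<lambda>w. (x w, y w, z w, p w, q w)) (\<lambda>w. (x' w, y' w, z' w, p w, q w))"
  unfolding relative_minimal_def pt_normal_comp
  using assms
  by (auto intro!: parallel_tangent_planes_same_normal relative_mean_curvature_vanishes_if_jacobian[OF assms(1)]
      simp: add.commute)

section \<open>Infinitesimal flexibility\<close>

text \<open>The top view of \<open>F + t V\<close> is the similarity \<open>(u, v) \<mapsto> (u - t v, v + t u)\<close>, whose inverse is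
  \<open>(x, y) \<mapsto> (a x + b y, - b x + a y)\<close> with \<open>a = 1 / (1 + t\<^sup>2)\<close> and \<open>b = t / (1 + t\<^sup>2)\<close>.\<close>

lemma partials_rotated:
  assumes "g differentiable (at (a * x + b * y, - b * x + a * y))"
  shows "Du (\<lambda>(x, y). g (a * x + b * y, - b * x + a * y)) (x, y) =
      a * Du g (a * x + b * y, - b * x + a * y) - b * Dv g (a * x + b * y, - b * x + a * y)" (is ?u)
    and "Dv (\<lambda>(x, y). g (a * x + b * y, - b * x + a * y)) (x, y) =
      b * Du g (a * x + b * y, - b * x + a * y) + a * Dv g (a * x + b * y, - b * x + a * y)" (is ?v)
proof -
  let ?R = "\<lambda>p :: real \<times> real. (a * fst p + b * snd p, - b * fst p + a * snd p)"
  have "(?R has_derivative ?R) (at (x, y))"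
    by (auto intro!: derivative_eq_intros)
  moreover have "(g has_derivative differential g (?R (x, y))) (at (?R (x, y)))"
    using assms by (intro has_derivative_differential) simp
  ultimately have "((\<lambda>p. g (?R p)) has_derivative (\<lambda>d. differential g (?R (x, y)) (?R d))) (at (x, y))"
    by (rule has_derivative_compose)
  from partials_eqI[OF this] show ?u ?v
    by (simp_all add: differential_def case_prod_beta')
qed

lemma partials_linear_combination:
  fixes g h :: "real \<times> real \<Rightarrow> real"
  assumes "g differentiable (at w)" and "h differentiable (at w)"
  shows "(\<lambda>w. a * g w + b * h w) differentiable (at w)"
    and "Du (\<lambda>w. a * g w + b * h w) w = a * Du g w + b * Du h w"
    and "Dv (\<lambda>w. a * g w + b * h w) w = a * Dv g w + b * Dv h w"
proof -
  have "((\<lambda>w. a * g w + b * h w) has_derivative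
      (\<lambda>d. a * differential g w d + b * differential h w d)) (at w)"
    by (intro has_derivative_add has_derivative_mult_right has_derivative_differential assms)
  then show "(\<lambda>w. a * g w + b * h w) differentiable (at w)"
    and "Du (\<lambda>w. a * g w + b * h w) w = a * Du g w + b * Du h w"
    and "Dv (\<lambda>w. a * g w + b * h w) w = a * Dv g w + b * Dv h w"
    by (auto simp: differentiable_def partials_eqI differential_def)
qed

lemma graph_function_rotated:
  fixes t :: real
  assumes "(u, v) \<in> U"
  shows "graph_function U (\<lambda>(u, v). (u - t * v, v + t * u, g (u, v))) (u - t * v, v + t * u) = g (u, v)"
proof -
  let ?A = "top_view \<circ> (\<lambda>(u, v). (u - t * v, v + t * u, g (u, v)))"
  have "0 < 1 + t * t"
    using zero_le_square[of t] by linarith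
  have "inj ?A"
  proof (rule injI)
    fix p p' assume A: "?A p = ?A p'"
    obtain u v u' v' where p: "p = (u, v)" "p' = (u', v')"
      by (cases p, cases p')
    have eq: "u - t * v = u' - t * v'" "v + t * u = v' + t * u'"
      using A by (simp_all add: p)
    have "(u - t * v) + t * (v + t * u) = (u' - t * v') + t * (v' + t * u')"
      "(v + t * u) - t * (u - t * v) = (v' + t * u') - t * (u' - t * v')"
      by (simp_all only: eq)
    then have "(1 + t * t) * u = (1 + t * t) * u'" "(1 + t * t) * v = (1 + t * t) * v'"
      by (simp_all add: algebra_simps)
    then show "p = p'"
      using \<open>0 < 1 + t * t\<close> by (simp add: p)
  qed
  then have "inv_into U ?A (?A (u, v)) = (u, v)"
    by (intro inv_into_f_f assms) (rule inj_on_subset[OF _ subset_UNIV])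
  then show ?thesis
    by (simp add: graph_function_def)
qed

text \<open>Both partial derivatives of a function composed with the similarity are again linear combinations
  of functions composed with it, so the substitution rule can be applied twice. It turns the Hessian
  \<open>H\<close> into \<open>R\<^sup>T H R\<close> with \<open>det R = a\<^sup>2 + b\<^sup>2 = 1 / (1 + t\<^sup>2)\<close>.\<close>

lemma isotropic_gauss_curvature_rotated:
  fixes g :: "real \<times> real \<Rightarrow> real" and t :: real
  assumes "open U" and "w \<in> U"
    and g: "\<And>w. w \<in> U \<Longrightarrow> g differentiable (at w)"
    and gu: "\<And>w. w \<in> U \<Longrightarrow> Du g differentiable (at w)"
    and gv: "\<And>w. w \<in> U \<Longrightarrow> Dv g differentiable (at w)"
    and sym: "Du (Dv g) w = Dv (Du g) w"
  shows "isotropic_gauss_curvature U (\<lambda>(u, v). (u - t * v, v + t * u, g (u, v))) w =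
    (Du (Du g) w * Dv (Dv g) w - (Dv (Du g) w)\<^sup>2) / (1 + t\<^sup>2)\<^sup>2"
proof -
  define k where "k = 1 + t\<^sup>2"
  define a where "a = 1 / k"
  define b where "b = t / k"
  have "0 < k"
    using zero_le_power2[of t] unfolding k_def by linarith
  have "a\<^sup>2 + b\<^sup>2 = k / k\<^sup>2"
    by (simp add: a_def b_def power_divide k_def add_divide_distrib)
  then have norm_ab: "a\<^sup>2 + b\<^sup>2 = 1 / k"
    by (simp add: power2_eq_square)
  let ?R = "\<lambda>(x, y). (a * x + b * y, - b * x + a * y)"
  let ?\<phi> = "graph_function U (\<lambda>(u, v). (u - t * v, v + t * u, g (u, v)))"
  define W where "W = ?R -` U"
  have "open W"
    unfolding W_def case_prod_beta' by (intro open_vimage[OF assms(1)] continuous_intros)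
  obtain u v where w: "w = (u, v)" by (cases w)
  let ?p = "(u - t * v, v + t * u)"
  have R_p: "?R ?p = w"
  proof -
    have "a * (u - t * v) + b * (v + t * u) = (1 + t\<^sup>2) * u / k"
      "- b * (u - t * v) + a * (v + t * u) = (1 + t\<^sup>2) * v / k"
      using \<open>0 < k\<close> by (simp_all add: a_def b_def field_simps power2_eq_square)
    then show ?thesis
      using \<open>0 < k\<close> by (simp add: w flip: k_def)
  qed
  then have "?p \<in> W"
    using \<open>w \<in> U\<close> by (simp add: W_def)
  let ?G = "\<lambda>(x, y). g (a * x + b * y, - b * x + a * y)"
  have \<phi>: "?\<phi> p = ?G p" if "p \<in> W" for p
  proof -
    obtain x y where p: "p = (x, y)" by (cases p)
    have "(a * x + b * y) - t * (- b * x + a * y) = (1 + t\<^sup>2) * x / k"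
      "(- b * x + a * y) + t * (a * x + b * y) = (1 + t\<^sup>2) * y / k"
      using \<open>0 < k\<close> by (simp_all add: a_def b_def field_simps power2_eq_square)
    then have "p = ((a * x + b * y) - t * (- b * x + a * y), (- b * x + a * y) + t * (a * x + b * y))"
      using \<open>0 < k\<close> by (simp add: p flip: k_def)
    then show ?thesis
      using graph_function_rotated[of "a * x + b * y" "- b * x + a * y" U t g] that
      by (simp add: p W_def)
  qed
  define gx where "gx = (\<lambda>w. a * Du g w + (- b) * Dv g w)"
  define gy where "gy = (\<lambda>w. b * Du g w + a * Dv g w)"
  have \<phi>x: "Du ?\<phi> p = (\<lambda>(x, y). gx (a * x + b * y, - b * x + a * y)) p"
    and \<phi>y: "Dv ?\<phi> p = (\<lambda>(x, y). gy (a * x + b * y, - b * x + a * y)) p" if "p \<in> W" for p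
  proof -
    obtain x y where p: "p = (x, y)" by (cases p)
    then have "g differentiable (at (a * x + b * y, - b * x + a * y))"
      using that by (intro g) (simp add: W_def)
    note rotated = partials_rotated[OF this]
    have "Du ?\<phi> p = Du ?G p" "Dv ?\<phi> p = Dv ?G p"
      by (intro partials_cong_open[OF \<open>open W\<close> that] \<phi>; assumption)+
    then show "Du ?\<phi> p = (\<lambda>(x, y). gx (a * x + b * y, - b * x + a * y)) p"
      and "Dv ?\<phi> p = (\<lambda>(x, y). gy (a * x + b * y, - b * x + a * y)) p"
      unfolding p rotated by (simp_all add: gx_def gy_def)
  qed
  have R_p': "(a * (u - t * v) + b * (v + t * u), - b * (u - t * v) + a * (v + t * u)) = w"
    using R_p by simp
  note gx = partials_linear_combination[OF gu[OF \<open>w \<in> U\<close>] gv[OF \<open>w \<in> U\<close>], of a "- b", folded gx_def]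
  note gy = partials_linear_combination[OF gu[OF \<open>w \<in> U\<close>] gv[OF \<open>w \<in> U\<close>], of b a, folded gy_def]
  have "Du (Du ?\<phi>) ?p = a * Du gx w - b * Dv gx w"
    "Dv (Du ?\<phi>) ?p = b * Du gx w + a * Dv gx w"
    "Dv (Dv ?\<phi>) ?p = b * Du gy w + a * Dv gy w"
    using partials_cong_open[OF \<open>open W\<close> \<open>?p \<in> W\<close> \<phi>x] partials_cong_open[OF \<open>open W\<close> \<open>?p \<in> W\<close> \<phi>y]
      partials_rotated[of gx a "u - t * v" b "v + t * u"]
      partials_rotated[of gy a "u - t * v" b "v + t * u"] gx(1) gy(1)
    by (simp_all only: R_p')
  then have "isotropic_gauss_curvature U (\<lambda>(u, v). (u - t * v, v + t * u, g (u, v))) w =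
      (a * Du gx w - b * Dv gx w) * (b * Du gy w + a * Dv gy w) - (b * Du gx w + a * Dv gx w)\<^sup>2"
    by (simp add: isotropic_gauss_curvature_def w)
  also have "\<dots> = (a\<^sup>2 + b\<^sup>2)\<^sup>2 * (Du (Du g) w * Dv (Dv g) w - (Dv (Du g) w)\<^sup>2)"
    unfolding gx(2,3) gy(2,3) sym power2_eq_square by (simp add: algebra_simps)
  finally show ?thesis
    unfolding norm_ab k_def[symmetric] by (simp add: power_divide)
qed

text \<open>Let \<open>D t\<close> be the Hessian determinant of \<open>f + t n\<close>. The curvature of \<open>F + t V\<close> is
  \<open>D t / (1 + t\<^sup>2)\<^sup>2\<close>, and the denominator is stationary at \<open>t = 0\<close>. So the curvature is preserved to
  first order if and only if \<open>D\<close> is, and the derivative of \<open>D\<close> at \<open>0\<close> is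
  \<open>f\<^sub>u\<^sub>u n\<^sub>v\<^sub>v - 2 f\<^sub>u\<^sub>v n\<^sub>u\<^sub>v + f\<^sub>v\<^sub>v n\<^sub>u\<^sub>u\<close>, the polarization of the determinant. It is the
  coefficient of \<open>df\<^sub>u \<and> dn\<^sub>v + dn\<^sub>u \<and> df\<^sub>v\<close>.\<close>

lemma infinitesimally_flexible_jacobian:
  assumes "open U" and f: "Ck_on 2 U f" and n: "Ck_on 2 U n" and "w \<in> U"
    and flexible: "infinitesimally_flexible U (pt \<circ> surf_F f) (pt \<circ> surf_V n)"
  shows "jacobian_det (Du f) (Dv n) w + jacobian_det (Du n) (Dv f) w = 0"
proof -
  let ?K = "\<lambda>t. ((Du (Du f) w + t * Du (Du n) w) * (Dv (Dv f) w + t * Dv (Dv n) w) -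
    (Dv (Du f) w + t * Dv (Du n) w)\<^sup>2) / (1 + t\<^sup>2)\<^sup>2"
  have C2: "g differentiable (at w)" "Du g differentiable (at w)" "Dv g differentiable (at w)"
    if "w \<in> U" and "Ck_on 2 U g" for w and g :: "real \<times> real \<Rightarrow> real"
    using that unfolding Ck_on_2_iff[OF assms(1)] Ck_on_1_iff[OF assms(1)] by blast+
  have K: "isotropic_gauss_curvature U (\<lambda>w. (pt \<circ> surf_F f) w + t *\<^sub>R (pt \<circ> surf_V n) w) w = ?K t" for t
  proof -
    define g where "g = (\<lambda>w. f w + t * n w)"
    define gu where "gu = (\<lambda>w. Du f w + t * Du n w)"
    define gv where "gv = (\<lambda>w. Dv f w + t * Dv n w)"
    have g: "g differentiable (at w)" "Du g w = gu w" "Dv g w = gv w" if "w \<in> U" for w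
      using partials_linear_combination[OF C2(1)[OF that f] C2(1)[OF that n], of 1 t]
      by (simp_all add: g_def gu_def gv_def)
    have gu: "gu differentiable (at w)" "Du gu w = Du (Du f) w + t * Du (Du n) w"
      "Dv gu w = Dv (Du f) w + t * Dv (Du n) w" if "w \<in> U" for w
      using partials_linear_combination[OF C2(2)[OF that f] C2(2)[OF that n], of 1 t]
      by (simp_all add: gu_def)
    have gv: "gv differentiable (at w)" "Du gv w = Du (Dv f) w + t * Du (Dv n) w"
      "Dv gv w = Dv (Dv f) w + t * Dv (Dv n) w" if "w \<in> U" for w
      using partials_linear_combination[OF C2(3)[OF that f] C2(3)[OF that n], of 1 t]
      by (simp_all add: gv_def)
    have diff: "Du g differentiable (at w)" "Dv g differentiable (at w)" if "w \<in> U" for w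
    proof -
      have "(Du g has_derivative differential gu w) (at w)"
        using has_derivative_differential[OF gu(1)[OF that]] assms(1) that
        by (rule has_derivative_transform_within_open) (simp add: g)
      moreover have "(Dv g has_derivative differential gv w) (at w)"
        using has_derivative_differential[OF gv(1)[OF that]] assms(1) that
        by (rule has_derivative_transform_within_open) (simp add: g)
      ultimately show "Du g differentiable (at w)" "Dv g differentiable (at w)"
        by (auto simp: differentiable_def)
    qed
    have "Du (Du g) w = Du gu w" "Dv (Du g) w = Dv gu w"
      "Du (Dv g) w = Du gv w" "Dv (Dv g) w = Dv gv w"
      by (intro partials_cong_open[OF assms(1) \<open>w \<in> U\<close>] g; assumption)+
    note second = this gu(2,3)[OF \<open>w \<in> U\<close>] gv(2,3)[OF \<open>w \<in> U\<close>]
    have "(\<lambda>w. (pt \<circ> surf_F f) w + t *\<^sub>R (pt \<circ> surf_V n) w) =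
        (\<lambda>(u, v). (u - t * v, v + t * u, g (u, v)))"
      by (auto simp: surf_F_def surf_V_def g_def)
    moreover have "isotropic_gauss_curvature U (\<lambda>(u, v). (u - t * v, v + t * u, g (u, v))) w =
        (Du (Du g) w * Dv (Dv g) w - (Dv (Du g) w)\<^sup>2) / (1 + t\<^sup>2)\<^sup>2"
    proof (rule isotropic_gauss_curvature_rotated[OF assms(1) \<open>w \<in> U\<close> g(1) diff])
      show "Du (Dv g) w = Dv (Du g) w"
        unfolding second mixed_partials_commute[OF assms(1) f \<open>w \<in> U\<close>]
          mixed_partials_commute[OF assms(1) n \<open>w \<in> U\<close>] ..
    qed
    ultimately show ?thesis
      by (simp only: second)
  qed
  have "((\<lambda>t. isotropic_gauss_curvature U (\<lambda>w. (pt \<circ> surf_F f) w + t *\<^sub>R (pt \<circ> surf_V n) w) w)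
      has_real_derivative 0) (at 0)"
    using flexible \<open>w \<in> U\<close> unfolding infinitesimally_flexible_def by blast
  then have "(?K has_real_derivative 0) (at 0)"
    unfolding K .
  moreover have "(?K has_real_derivative Du (Du f) w * Dv (Dv n) w + Du (Du n) w * Dv (Dv f) w
      - 2 * Dv (Du f) w * Dv (Du n) w) (at 0)"
    by (auto intro!: derivative_eq_intros)
  ultimately have "Du (Du f) w * Dv (Dv n) w + Du (Du n) w * Dv (Dv f) w
      - 2 * Dv (Du f) w * Dv (Du n) w = 0"
    by (rule DERIV_unique[symmetric])
  then show ?thesis
    using mixed_partials_commute[OF assms(1) f \<open>w \<in> U\<close>] mixed_partials_commute[OF assms(1) n \<open>w \<in> U\<close>]
    by (simp add: jacobian_det_def)
qed
section \<open>The six surfaces of an infinitesimal deformation\<close>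

lemma surf_components:
  "surf_F f = (\<lambda>w. (fst w, snd w, f w, Du f w, Dv f w))"
  "surf_V n = (\<lambda>w. (- snd w, fst w, n w, - Dv n w, Du n w))"
  "surf_C f n c = (\<lambda>w. (- Du n w, - Dv n w, c w, Dv f w, - Du f w))"
  by (simp_all add: surf_F_def surf_V_def surf_C_def case_prod_beta')

lemma nu_surf:
  "nu \<circ> (motion_L \<circ> surf_V n) = surf_C_bar n"
  "nu \<circ> surf_C_bar n = motion_L \<circ> surf_V n"
  "nu \<circ> (motion_L \<circ> surf_B f) = surf_F f"
  "nu \<circ> surf_F f = motion_L \<circ> surf_B f"
  "nu \<circ> (motion_L \<circ> surf_C f n c) = surf_B_bar f n c"
  "nu \<circ> surf_B_bar f n c = motion_L \<circ> surf_C f n c"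
  by (auto simp: fun_eq_iff surf_F_def surf_V_def surf_C_def surf_B_def surf_B_bar_def surf_C_bar_def
      algebra_simps)

text \<open>Only \<open>C\<close> needs an argument: \<open>dc = - f\<^sub>v dn\<^sub>u + f\<^sub>u dn\<^sub>v\<close> is the definition of \<open>c\<close> after exchanging
  the order of differentiation in \<open>n\<^sub>u\<^sub>v\<close>.\<close>

lemma contact_surface_surf:
  assumes "open U" and f: "Ck_on 2 U f" and n: "Ck_on 2 U n" and c: "Ck_on 1 U c"
    and "\<forall>w\<in>U. Du c w = Du f w * Dv (Du n) w - Dv f w * Du (Du n) w"
    and "\<forall>w\<in>U. Dv c w = Du f w * Dv (Dv n) w - Dv f w * Dv (Du n) w"
  shows "contact_surface U (surf_F f)" and "contact_surface U (surf_V n)"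
    and "contact_surface U (surf_C f n c)"
proof -
  note C1 = Ck_on_2_imp_Ck_on_1[OF assms(1) f] Ck_on_2_imp_Ck_on_1[OF assms(1) n]
    Ck_on_1_coordinates Ck_on_1_minus[OF assms(1)]
  have diff: "Du n differentiable (at w)" "Dv n differentiable (at w)" if "w \<in> U" for w
    using Ck_on_1_differentiable[OF assms(1) _ that] C1 by blast+
  have diff_snd: "snd differentiable (at w)" for w :: "real \<times> real"
    by (intro bounded_linear_imp_differentiable bounded_linear_snd)
  show "contact_surface U (surf_F f)"
    unfolding surf_components contact_surface_iff[OF assms(1)]
    by (intro conjI C1) simp
  show "contact_surface U (surf_V n)"
    unfolding surf_components contact_surface_iff[OF assms(1)]
    by (intro conjI C1) (simp add: partials_minus diff_snd)
  show "contact_surface U (surf_C f n c)"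
    unfolding surf_components contact_surface_iff[OF assms(1)]
    using assms(5,6) mixed_partials_commute[OF assms(1) n]
    by (intro conjI C1 c) (simp add: partials_minus diff)
qed

theorem theorem51:
  fixes U :: "(real \<times> real) set" and f n c :: "real \<times> real \<Rightarrow> real"
  assumes "open U"
    and "Ck_on 2 U f" and "Ck_on 2 U n" and "Ck_on 1 U c"
    and "infinitesimally_flexible U (pt \<circ> surf_F f) (pt \<circ> surf_V n)"
    and "\<forall>w\<in>U. Du c w = Du f w * Dv (Du n) w - Dv f w * Du (Du n) w"
    and "\<forall>w\<in>U. Dv c w = Du f w * Dv (Dv n) w - Dv f w * Dv (Du n) w"
  shows
    "(nu_related U (motion_L \<circ> surf_V n) (surf_C_bar n) \<and>
      nu_related U (motion_L \<circ> surf_B f) (surf_F f) \<and>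
      nu_related U (motion_L \<circ> surf_C f n c) (surf_B_bar f n c))
     \<and>
     (weingarten_related U (motion_L \<circ> surf_V n) (surf_C_bar n) \<and>
      weingarten_related U (motion_L \<circ> surf_B f) (surf_F f) \<and>
      weingarten_related U (motion_L \<circ> surf_C f n c) (surf_B_bar f n c))
     \<and>
     ((parallel_tangent_planes U (surf_F f) (motion_L \<circ> surf_C f n c) \<and>
       parallel_tangent_planes U (surf_C_bar n) (motion_L \<circ> surf_B f) \<and>
       parallel_tangent_planes U (surf_B_bar f n c) (motion_L \<circ> surf_V n)) \<and>
      (relative_minimal U (surf_F f) (motion_L \<circ> surf_C f n c) \<and>
       relative_minimal U (surf_C_bar n) (motion_L \<circ> surf_B f) \<and>
       relative_minimal U (surf_B_bar f n c) (motion_L \<circ> surf_V n)))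
     \<and>
     ((same_top_view U (motion_L \<circ> surf_V n) (surf_F f) \<and>
       same_top_view U (motion_L \<circ> surf_C f n c) (surf_C_bar n) \<and>
       same_top_view U (motion_L \<circ> surf_B f) (surf_B_bar f n c)) \<and>
      (dual_relative_minimal U (motion_L \<circ> surf_V n) (surf_F f) \<and>
       dual_relative_minimal U (motion_L \<circ> surf_C f n c) (surf_C_bar n) \<and>
       dual_relative_minimal U (motion_L \<circ> surf_B f) (surf_B_bar f n c)))"
proof -
  note surf = contact_surface_surf[OF assms(1-4,6,7)]
  have contact: "contact_surface U (surf_F f)" "contact_surface U (motion_L \<circ> surf_V n)"
    "contact_surface U (motion_L \<circ> surf_C f n c)" "contact_surface U (motion_L \<circ> surf_B f)"
    "contact_surface U (surf_C_bar n)" "contact_surface U (surf_B_bar f n c)"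
    using surf contact_surface_motion_L[OF assms(1)] contact_surface_nu[OF assms(1)]
    by (metis nu_surf)+
  have L_components:
    "motion_L \<circ> surf_V n = (\<lambda>w. (fst w, snd w, - n w, - Du n w, - Dv n w))"
    "motion_L \<circ> surf_C f n c = (\<lambda>w. (- Dv n w, Du n w, - c w, Du f w, Dv f w))"
    "motion_L \<circ> surf_B f = (\<lambda>w. (Dv f w, - Du f w,
      - (Du f w * fst w + Dv f w * snd w - f w), - snd w, fst w))"
    by (auto simp: fun_eq_iff surf_V_def surf_C_def surf_B_def)
  have bar_components:
    "surf_C_bar n = (\<lambda>w. (- Dv n w, Du n w, Du n w * fst w + Dv n w * snd w - n w, - snd w, fst w))"
    "surf_B_bar f n c = (\<lambda>w. (Dv f w, - Du f w, - Du n w * Dv f w + Dv n w * Du f w - c w,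
      - Du n w, - Dv n w))"
    by (auto simp: fun_eq_iff surf_C_bar_def surf_B_bar_def)
  have diff: "Du f differentiable (at w)" "Dv f differentiable (at w)"
    "Du n differentiable (at w)" "Dv n differentiable (at w)" "snd differentiable (at w)"
    if "w \<in> U" for w
    using assms(2,3) that unfolding Ck_on_2_iff[OF assms(1)] Ck_on_1_iff[OF assms(1)]
    by (auto intro: bounded_linear_imp_differentiable bounded_linear_snd)
  have f: "Du (Dv f) w = Dv (Du f) w" and n: "Du (Dv n) w = Dv (Du n) w"
    and fn: "jacobian_det (Du f) (Dv n) w + jacobian_det (Du n) (Dv f) w = 0" if "w \<in> U" for w
    using mixed_partials_commute[OF assms(1) _ that] assms(2,3)
      infinitesimally_flexible_jacobian[OF assms(1-3) that assms(5)] by blast+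
  note jacobian_simps = jacobian_det_def partials_minus diff f n
  \<comment> \<open>The relations \<open>dx \<and> dp + dy \<and> dq = 0\<close> of \<open>LV\<close>, \<open>LB\<close> and \<open>LC\<close>, then the relations
    \<open>dx \<and> dy' + dx' \<and> dy = 0\<close> of \<open>(F, LC)\<close>, \<open>(C_bar, LB)\<close> and \<open>(B_bar, LV)\<close>.\<close>
  have jacobian_forms:
    "jacobian_det fst (\<lambda>w. - Du n w) w + jacobian_det snd (\<lambda>w. - Dv n w) w = 0"
    "jacobian_det (Dv f) (\<lambda>w. - snd w) w + jacobian_det (\<lambda>w. - Du f w) fst w = 0"
    "jacobian_det (\<lambda>w. - Dv n w) (Du f) w + jacobian_det (Du n) (Dv f) w = 0"
    and jacobian_mixed:
    "jacobian_det fst (Du n) w + jacobian_det (\<lambda>w. - Dv n w) snd w = 0"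
    "jacobian_det (\<lambda>w. - Dv n w) (\<lambda>w. - Du f w) w + jacobian_det (Dv f) (Du n) w = 0"
    "jacobian_det (Dv f) snd w + jacobian_det fst (\<lambda>w. - Du f w) w = 0" if "w \<in> U" for w
    using fn[OF that] by (simp_all add: jacobian_simps that algebra_simps)

  have nu_rel: "nu_related U (motion_L \<circ> surf_V n) (surf_C_bar n)"
    "nu_related U (motion_L \<circ> surf_B f) (surf_F f)"
    "nu_related U (motion_L \<circ> surf_C f n c) (surf_B_bar f n c)"
    using contact by (simp_all add: nu_related_def flip: nu_surf(1,3,5))

  have symmetric: "second_form (motion_L \<circ> surf_V n) w a b = second_form (motion_L \<circ> surf_V n) w b a"
    "second_form (motion_L \<circ> surf_B f) w a b = second_form (motion_L \<circ> surf_B f) w b a"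
    "second_form (motion_L \<circ> surf_C f n c) w a b = second_form (motion_L \<circ> surf_C f n c) w b a"
    if "w \<in> U" for w a b
    unfolding L_components
    by (rule second_form_symmetric[OF assms(1) contact(2)[unfolded L_components] that jacobian_forms(1)[OF that]]
        second_form_symmetric[OF assms(1) contact(4)[unfolded L_components] that jacobian_forms(2)[OF that]]
        second_form_symmetric[OF assms(1) contact(3)[unfolded L_components] that jacobian_forms(3)[OF that]])+
  have weingarten: "weingarten_related U (motion_L \<circ> surf_V n) (surf_C_bar n)"
    "weingarten_related U (motion_L \<circ> surf_B f) (surf_F f)"
    "weingarten_related U (motion_L \<circ> surf_C f n c) (surf_B_bar f n c)"
    unfolding nu_surf(1,3,5)[symmetric]
    by (rule weingarten_related_nu[OF assms(1) contact(2) symmetric(1)]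
        weingarten_related_nu[OF assms(1) contact(4) symmetric(2)]
        weingarten_related_nu[OF assms(1) contact(3) symmetric(3)]; assumption)+

  note components = L_components bar_components surf_components(1)
  have minimal: "relative_minimal U (surf_F f) (motion_L \<circ> surf_C f n c)"
    "relative_minimal U (surf_C_bar n) (motion_L \<circ> surf_B f)"
    "relative_minimal U (surf_B_bar f n c) (motion_L \<circ> surf_V n)"
    unfolding components
    by (rule relative_minimal_if_jacobian[OF assms(1) contact(1,3)[unfolded components] jacobian_mixed(1)]
        relative_minimal_if_jacobian[OF assms(1) contact(5,4)[unfolded components] jacobian_mixed(2)]
        relative_minimal_if_jacobian[OF assms(1) contact(6,2)[unfolded components] jacobian_mixed(3)]; assumption)+
  then have parallel: "parallel_tangent_planes U (surf_F f) (motion_L \<circ> surf_C f n c)"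
    "parallel_tangent_planes U (surf_C_bar n) (motion_L \<circ> surf_B f)"
    "parallel_tangent_planes U (surf_B_bar f n c) (motion_L \<circ> surf_V n)"
    by (simp_all add: relative_minimal_def)

  have top: "same_top_view U (motion_L \<circ> surf_V n) (surf_F f)"
    "same_top_view U (motion_L \<circ> surf_C f n c) (surf_C_bar n)"
    "same_top_view U (motion_L \<circ> surf_B f) (surf_B_bar f n c)"
    unfolding L_components bar_components surf_components(1) by (simp_all add: same_top_view_def)
  \<comment> \<open>\<open>\<nu>\<close> permutes the six surfaces, taking these three pairs to the relative minimal ones.\<close>
  have "dual_relative_minimal U (motion_L \<circ> surf_V n) (surf_F f)"
    "dual_relative_minimal U (motion_L \<circ> surf_C f n c) (surf_C_bar n)"
    "dual_relative_minimal U (motion_L \<circ> surf_B f) (surf_B_bar f n c)"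
    unfolding dual_relative_minimal_def nu_surf
    by (intro conjI contact top minimal)+
  with nu_rel weingarten minimal parallel top show ?thesis
    by blast
qed

end
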